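(* Let $p \geq 4$ be an integer. Then: $$F(2,2,p;p+1) \leq \frac{13p}{4} \quad \text{if } p \equiv 0 \pmod 4;$$ $$F(2,2,p;p+1) \leq \frac{13p+23}{4} \quad \text{if } p \equiv 1 \pmod 4;$$ $$F(2,2,p;p+1) \leq \frac{13p+10}{4} \quad \text{if } p \equiv 2 \pmod 4;$$ $$F(2,2,p;p+1) \leq \frac{13p+21}{4} \quad \text{if } p \equiv 3 \pmod 4.$$
   Context: All graphs are finite, undirected, without loops or multiple edges. $V(G)$ denotes the vertex set of $G$. A $p$-clique of $G$ is a set of $p$ pairwise adjacent vertices, and $cl(G)$ is the largest $p$ such that $G$ contains a $p$-clique. For positive integers $a_1,\dots,a_r$, an $r$-coloring $V(G) = V_1 \cup \dots \cup V_r$ (with $V_i \cap V_j = \emptyset$ for $i \neq j$) is called $(a_1,\dots,a_r)$-free if, for each $i$, $V_i$ does not contain an $a_i$-clique. The notation $G \rightarrow (a_1,\dots,a_r)$ means that there is no $(a_1,\dots,a_r)$-free $r$-coloring of $V(G)$. For a positive integer $q$, the vertex Folkman number is $$F(a_1,\dots,a_r;q) = \min\{|V(G)| : G \rightarrow (a_1,\dots,a_r) \text{ and } cl(G) < q\}.$$ By a theorem of Folkman, such graphs $G$ exist (so the minimum is well defined) if and only if $q > \max\{a_1,\dots,a_r\}$. *)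

theory Defs
  imports Complex_Main "HOL-Library.Ramsey" "HOL-Library.Disjoint_Sets"
begin

text \<open>
  A finite simple graph is given by its vertex set \<open>V\<close> and its set \<open>E\<close> of edges, an edge being
  a two-element subset of \<open>V\<close>. Cliques are those of \<^theory>\<open>HOL-Library.Ramsey\<close>.
\<close>

definition simple_graph :: "'a set \<Rightarrow> 'a set set \<Rightarrow> bool" where
  "simple_graph V E \<longleftrightarrow> finite V \<and> E \<subseteq> nsets V 2"

definition contains_clique :: "'a set set \<Rightarrow> nat \<Rightarrow> 'a set \<Rightarrow> bool" where
  "contains_clique E p W \<longleftrightarrow> (\<exists>K \<subseteq> W. finite K \<and> card K = p \<and> clique K E)"

definition clique_number :: "'a set \<Rightarrow> 'a set set \<Rightarrow> nat" where
  "clique_number V E = Max {p. contains_clique E p V}"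

text \<open>The tuple \<open>(a\<^sub>1, \<dots>, a\<^sub>r)\<close> is a list, so the colour classes are indexed from 0; they may be empty.\<close>

definition is_coloring :: "nat \<Rightarrow> 'a set \<Rightarrow> (nat \<Rightarrow> 'a set) \<Rightarrow> bool" where
  "is_coloring r V C \<longleftrightarrow> (\<Union>i<r. C i) = V \<and> disjoint_family_on C {..<r}"

definition free_coloring :: "'a set set \<Rightarrow> nat list \<Rightarrow> (nat \<Rightarrow> 'a set) \<Rightarrow> bool" where
  "free_coloring E as C \<longleftrightarrow> (\<forall>i < length as. \<not> contains_clique E (as ! i) (C i))"

definition arrows :: "'a set \<Rightarrow> 'a set set \<Rightarrow> nat list \<Rightarrow> bool" where
  "arrows V E as \<longleftrightarrow> \<not> (\<exists>C. is_coloring (length as) V C \<and> free_coloring E as C)"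

text \<open>
  Every finite graph is isomorphic to one whose vertices are natural numbers, so the minimum may
  be taken over the latter. If no suitable graph exists, the value is unspecified (it is not 0), so
  that an upper bound on it cannot hold vacuously.
\<close>

definition folkman_number :: "nat list \<Rightarrow> nat \<Rightarrow> nat" where
  "folkman_number as q =
    (LEAST n. \<exists>(V :: nat set) E.
       simple_graph V E \<and> card V = n \<and> arrows V E as \<and> clique_number V E < q)"

end

theory Submission
  imports Defs "HOL-Library.Code_Binary_Nat"
begin

text \<open>
  If \<open>G \<rightarrow> (2,2,p)\<close> with \<open>cl(G) = p\<close> and \<open>H \<rightarrow> (2,2,q)\<close> with \<open>cl(H) = q\<close>, then the join of \<open>G\<close>
  and \<open>H\<close> arrows \<open>(2,2,p+q)\<close> and has clique number \<open>p + q\<close>: outside two given independent sets one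
  finds a \<open>p\<close>-clique in \<open>G\<close> and a \<open>q\<close>-clique in \<open>H\<close>. Repeatedly joining a graph on 13 vertices for
  \<open>p = 4\<close> reduces the theorem to \<open>p = 4, 5, 6, 7\<close>, where complements of circulant graphs on
  13, 22, 21 and 24 vertices do; these are checked by computation.
\<close>

section \<open>Graphs on an initial segment of the natural numbers\<close>

text \<open>
  A graph on \<open>{..<n}\<close> is given by a relation \<open>R\<close> of which only the values \<open>R x y\<close> with \<open>x < y\<close> matter.
\<close>

definition pairwise_adj :: "(nat \<Rightarrow> nat \<Rightarrow> bool) \<Rightarrow> nat set \<Rightarrow> bool" where
  "pairwise_adj R K \<longleftrightarrow> (\<forall>x\<in>K. \<forall>y\<in>K. x < y \<longrightarrow> R x y)"

definition independent :: "(nat \<Rightarrow> nat \<Rightarrow> bool) \<Rightarrow> nat set \<Rightarrow> bool" where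
  "independent R A \<longleftrightarrow> (\<forall>x\<in>A. \<forall>y\<in>A. x < y \<longrightarrow> \<not> R x y)"

text \<open>\<open>A\<close> and \<open>B\<close> play the colour classes with forbidden 2-clique.
  They may overlap or leave \<open>{..<n}\<close>, so passing to the summands of a join creates no
  side conditions.\<close>

definition folkman_witness :: "(nat \<Rightarrow> nat \<Rightarrow> bool) \<Rightarrow> nat \<Rightarrow> nat \<Rightarrow> bool" where
  "folkman_witness R p n \<longleftrightarrow>
     (\<forall>K \<subseteq> {..<n}. pairwise_adj R K \<longrightarrow> card K \<le> p) \<and>
     (\<forall>A B. independent R A \<longrightarrow> independent R B \<longrightarrow>
        (\<exists>K \<subseteq> {..<n}. pairwise_adj R K \<and> card K = p \<and> K \<inter> A = {} \<and> K \<inter> B = {}))"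

text \<open>The two classes without a 2-clique are independent, so the \<open>p\<close>-clique
  missing both lies in the third class.\<close>

lemma folkman_number_le:
  assumes "folkman_witness R p n"
  shows "folkman_number [2, 2, p] (p + 1) \<le> n"
proof -
  define V where "V = {..<n}"
  define E where "E = {{x, y} | x y. x < y \<and> y < n \<and> R x y}"
  have edge: "{x, y} \<in> E \<longleftrightarrow> y < n \<and> R x y" if "x < y" for x y
    using that by (auto simp: E_def doubleton_eq_iff)
  have clique: "clique K E \<longleftrightarrow> pairwise_adj R K" if "K \<subseteq> V" for K
  proof
    assume "clique K E"
    then show "pairwise_adj R K"
      unfolding pairwise_adj_def clique_def by (metis edge less_irrefl)
  next
    assume adj: "pairwise_adj R K"
    show "clique K E"
      unfolding clique_def
    proof (intro ballI impI)
      fix v w assume "v \<in> K" "w \<in> K" "v \<noteq> w"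
      then show "{v, w} \<in> E"
        using that adj edge[of v w] edge[of w v]
        by (cases "v < w") (auto simp: pairwise_adj_def V_def insert_commute)
    qed
  qed
  have "simple_graph V E"
    by (auto simp: simple_graph_def V_def E_def nsets_def)
  moreover have "arrows V E [2, 2, p]"
    unfolding arrows_def
  proof clarify
    fix C assume col: "is_coloring (length [2, 2, p]) V C" and free: "free_coloring E [2, 2, p] C"
    have V: "V = C 0 \<union> C 1 \<union> C 2"
      using col by (auto simp: is_coloring_def numeral_3_eq_3 lessThan_Suc numeral_2_eq_2)
    have no: "\<not> contains_clique E 2 (C 0)" "\<not> contains_clique E 2 (C 1)"
      "\<not> contains_clique E p (C 2)"
      using free by (auto simp: free_coloring_def All_less_Suc numeral_2_eq_2)
    have indep: "independent R A" if "\<not> contains_clique E 2 A" "A \<subseteq> V" for A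
      unfolding independent_def
    proof (intro ballI impI notI)
      fix x y assume "x \<in> A" "y \<in> A" "x < y" "R x y"
      moreover from this have "{x, y} \<subseteq> V"
        using that(2) by auto
      ultimately have "{x, y} \<subseteq> A" "card {x, y} = 2" "clique {x, y} E"
        by (auto simp: clique pairwise_adj_def)
      then show False
        using that(1) unfolding contains_clique_def by blast
    qed
    obtain K where K: "K \<subseteq> V" "pairwise_adj R K" "card K = p" "K \<inter> C 0 = {}" "K \<inter> C 1 = {}"
      using assms indep[OF no(1)] indep[OF no(2)] V unfolding folkman_witness_def V_def by blast
    have "clique K E"
      using clique[OF K(1)] K(2) by simp
    moreover have "finite K"
      using finite_subset[OF K(1)] by (simp add: V_def)
    moreover have "K \<subseteq> C 2"
      using K(1,4,5) unfolding V by blast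
    ultimately show False
      using no(3) K(3) by (auto simp: contains_clique_def)
  qed
  moreover have "clique_number V E < p + 1"
  proof -
    have "q \<le> p" if q: "contains_clique E q V" for q
    proof -
      obtain K where K: "K \<subseteq> V" "card K = q" "clique K E"
        using q by (auto simp: contains_clique_def)
      have "pairwise_adj R K"
        using clique[OF K(1)] K(3) by simp
      then have "card K \<le> p"
        using assms K(1) unfolding folkman_witness_def V_def by (elim conjE allE[of _ K]) simp
      then show ?thesis
        using K(2) by simp
    qed
    \<comment> \<open>The empty clique keeps the set under \<open>Max\<close> nonempty.\<close>
    moreover have "contains_clique E 0 V"
      unfolding contains_clique_def clique_def by (intro exI[of _ "{}"]) auto
    ultimately show ?thesis
      unfolding clique_number_def
      by (subst Max_less_iff) (auto simp: less_Suc_eq_le intro: finite_subset[of _ "{..p}"])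
  qed
  ultimately show ?thesis
    unfolding folkman_number_def by (intro Least_le) (use V_def in auto)
qed

text \<open>The second graph is shifted by \<open>m\<close>. As only \<open>x < y\<close> matters,
  \<open>y < m\<close> puts both vertices into the first graph; otherwise \<open>x < m\<close> means
  a cross edge.\<close>

definition graph_join :: "nat \<Rightarrow> (nat \<Rightarrow> nat \<Rightarrow> bool) \<Rightarrow> (nat \<Rightarrow> nat \<Rightarrow> bool) \<Rightarrow> nat \<Rightarrow> nat \<Rightarrow> bool" where
  "graph_join m R S x y = (if y < m then R x y else if x < m then True else S (x - m) (y - m))"

lemma folkman_witness_join:
  assumes R: "folkman_witness R p m" and S: "folkman_witness S q n"
  shows "folkman_witness (graph_join m R S) (p + q) (m + n)"
  unfolding folkman_witness_def
proof safe
  fix K assume K: "K \<subseteq> {..<m + n}" "pairwise_adj (graph_join m R S) K"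
  define K1 K2 where "K1 = K \<inter> {..<m}" and "K2 = {x. x + m \<in> K}"
  have "K = K1 \<union> (\<lambda>x. x + m) ` K2"
    by (auto simp: K1_def K2_def image_iff) (metis le_add_diff_inverse2 not_less)
  moreover have "K1 \<subseteq> {..<m}" "pairwise_adj R K1"
    using K by (auto simp: K1_def pairwise_adj_def graph_join_def)
  moreover have "K2 \<subseteq> {..<n}" "pairwise_adj S K2"
    using K by (force simp: K2_def pairwise_adj_def graph_join_def)+
  ultimately have "card K \<le> card K1 + card ((\<lambda>x. x + m) ` K2)" "card K1 \<le> p" "card K2 \<le> q"
    using R S card_Un_le unfolding folkman_witness_def by auto
  then show "card K \<le> p + q"
    by (simp add: card_image)
next
  fix A B assume AB: "independent (graph_join m R S) A" "independent (graph_join m R S) B"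
  have left: "independent R (C \<inter> {..<m})" if "independent (graph_join m R S) C" for C
    using that by (force simp: independent_def graph_join_def)
  have right: "independent S {x. x + m \<in> C}" if "independent (graph_join m R S) C" for C
    using that by (force simp: independent_def graph_join_def)
  obtain K1 where K1: "K1 \<subseteq> {..<m}" "pairwise_adj R K1" "card K1 = p"
      "K1 \<inter> (A \<inter> {..<m}) = {}" "K1 \<inter> (B \<inter> {..<m}) = {}"
    using R left[OF AB(1)] left[OF AB(2)] unfolding folkman_witness_def by blast
  obtain K2 where K2: "K2 \<subseteq> {..<n}" "pairwise_adj S K2" "card K2 = q"
      "K2 \<inter> {x. x + m \<in> A} = {}" "K2 \<inter> {x. x + m \<in> B} = {}"
    using S right[OF AB(1)] right[OF AB(2)] unfolding folkman_witness_def by blast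
  define K where "K = K1 \<union> (\<lambda>x. x + m) ` K2"
  have "K1 \<inter> (\<lambda>x. x + m) ` K2 = {}"
    using K1(1) by auto
  then have "card K = p + q"
    using K1 K2 finite_subset[OF K1(1)] finite_subset[OF K2(1)]
    by (simp add: K_def card_Un_disjoint card_image)
  moreover have "K \<subseteq> {..<m + n}" "K \<inter> A = {}" "K \<inter> B = {}"
    using K1 K2 by (auto simp: K_def)
  moreover have "pairwise_adj (graph_join m R S) K"
    using K1(1,2) K2(1,2) by (auto simp: K_def pairwise_adj_def graph_join_def)
  ultimately show "\<exists>K\<subseteq>{..<m + n}. pairwise_adj (graph_join m R S) K \<and> card K = p + q \<and>
      K \<inter> A = {} \<and> K \<inter> B = {}"
    by blast
qed

section \<open>Certificates\<close>

fun cliques :: "(nat \<Rightarrow> nat \<Rightarrow> bool) \<Rightarrow> nat \<Rightarrow> nat list \<Rightarrow> nat list list" where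
  "cliques R k [] = (if k = 0 then [[]] else [])"
| "cliques R k (v # vs) =
     (if k = 0 then [[]]
      else map ((#) v) (cliques R (k - 1) (filter (R v) vs)) @ cliques R k vs)"

text \<open>If the head \<open>v\<close> lies in \<open>K\<close>, sortedness makes it the least
  vertex of \<open>K\<close>, so \<open>K - {v}\<close> survives \<open>filter (R v)\<close>. An
  empty search result therefore rules out a clique.\<close>

lemma cliques_nonempty:
  assumes "sorted_wrt (<) vs" "K \<subseteq> set vs" "pairwise_adj R K" "card K = k"
  shows "cliques R k vs \<noteq> []"
  using assms
proof (induction R k vs arbitrary: K rule: cliques.induct)
  case (2 R k v vs)
  show ?case
  proof (cases "k = 0 \<or> v \<notin> K")
    case True
    then show ?thesis
      using "2.IH"(2)[of K] "2.prems" by auto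
  next
    case False
    have "finite K"
      using "2.prems"(2) finite_subset by blast
    then have "cliques R (k - 1) (filter (R v) vs) \<noteq> []"
      using False "2.prems"
      by (intro "2.IH"(1)[of "K - {v}"]) (auto simp: pairwise_adj_def sorted_wrt_filter)
    then show ?thesis
      using False by simp
  qed
qed auto

text \<open>
  Searches for independent sets extending \<open>X\<close> and \<open>Y\<close> that together meet every member of a family:
  one of the vertices of the first member has to be added to \<open>X\<close> or to \<open>Y\<close>. The conditionals prevent
  the simplifier from evaluating pruned branches.
\<close>

fun hits :: "(nat \<Rightarrow> nat \<Rightarrow> bool) \<Rightarrow> nat list list \<Rightarrow> nat list \<Rightarrow> nat list \<Rightarrow> bool" where
  "hits R [] X Y = True"
| "hits R (K # L) X Y = list_ex (\<lambda>v.
     (if list_all (\<lambda>x. \<not> R (min v x) (max v x)) X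
      then hits R (filter (\<lambda>K. v \<notin> set K) L) (v # X) Y else False) \<or>
     (if list_all (\<lambda>x. \<not> R (min v x) (max v x)) Y
      then hits R (filter (\<lambda>K. v \<notin> set K) L) X (v # Y) else False)) K"

text \<open>The search can follow \<open>A\<close> and \<open>B\<close>: the first member of
  \<open>L\<close> has a vertex in one of them, which may join \<open>X\<close> or \<open>Y\<close>
  accordingly. Contrapositively, a failed search leaves a member missing both sets.\<close>

lemma hits_if_independent_cover:
  assumes "independent R A" "independent R B"
    and "set X \<subseteq> A" "set Y \<subseteq> B" "\<forall>K\<in>set L. \<not> set K \<inter> (set X \<union> set Y) \<noteq> {}"
    and "\<forall>K\<in>set L. set K \<inter> (A \<union> B) \<noteq> {}"
  shows "hits R L X Y"
  using assms(3-)
proof (induction "length L" arbitrary: L X Y rule: less_induct)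
  case less
  show ?case
  proof (cases L)
    case (Cons K L')
    have fits: "list_all (\<lambda>x. \<not> R (min v x) (max v x)) Z"
      if "independent R C" "v \<in> C" "set Z \<subseteq> C" "v \<notin> set Z" for C v Z
      unfolding list_all_iff
    proof
      fix x assume "x \<in> set Z"
      with that have "x \<in> C" "x \<noteq> v"
        by auto
      with that show "\<not> R (min v x) (max v x)"
        by (cases "v < x") (auto simp: independent_def min_def max_def)
    qed
    obtain v where v: "v \<in> set K" "v \<in> A \<or> v \<in> B"
      using less.prems Cons by auto
    \<comment> \<open>Freshness of \<open>v\<close> matters, since independence says nothing about
      \<open>R v v\<close>.\<close>
    have new: "v \<notin> set X" "v \<notin> set Y"
      using less.prems(3) Cons v(1) by auto
    let ?L = "filter (\<lambda>K. v \<notin> set K) L'"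
    have len: "length ?L < length L"
      using Cons by (simp add: le_imp_less_Suc)
    from v(2) show ?thesis
    proof
      assume "v \<in> A"
      then have "hits R ?L (v # X) Y"
        using less.prems Cons by (intro less.hyps[OF len]) auto
      then show ?thesis
        using Cons v(1) fits[OF assms(1) \<open>v \<in> A\<close> less.prems(1) new(1)] by (auto simp: list_ex_iff)
    next
      assume "v \<in> B"
      then have "hits R ?L X (v # Y)"
        using less.prems Cons by (intro less.hyps[OF len]) auto
      then show ?thesis
        using Cons v(1) fits[OF assms(2) \<open>v \<in> B\<close> less.prems(2) new(2)] by (auto simp: list_ex_iff)
    qed
  qed simp
qed

text \<open>The two independent sets play symmetric roles, so the first vertex may be put into \<open>X\<close>.\<close>

fun certificate :: "(nat \<Rightarrow> nat \<Rightarrow> bool) \<Rightarrow> nat \<Rightarrow> nat \<Rightarrow> nat list list \<Rightarrow> bool" where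
  "certificate R p n [] = False"
| "certificate R p n (K # L) \<longleftrightarrow>
     cliques R (p + 1) [0..<n] = [] \<and>
     list_all (\<lambda>K. length K = p \<and> distinct K \<and> list_all (\<lambda>x. x < n) K \<and>
       list_all (\<lambda>x. list_all (\<lambda>y. if x < y then R x y else True) K) K) (K # L) \<and>
     list_all (\<lambda>v. \<not> hits R (filter (\<lambda>K. v \<notin> set K) L) [v] []) K"

lemma folkman_witness_if_certificate:
  assumes cert: "certificate R p n L"
  shows "folkman_witness R p n"
proof -
  obtain K0 L' where L: "L = K0 # L'"
    using cert by (cases L) auto
  have no_hits: "\<not> hits R (filter (\<lambda>K. v \<notin> set K) L') [v] []" if "v \<in> set K0" for v
    using cert that unfolding L by (simp add: list_all_iff)
  have members: "pairwise_adj R (set K) \<and> card (set K) = p \<and> set K \<subseteq> {..<n}" if "K \<in> set L" for K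
    using cert that distinct_card[of K] unfolding L certificate.simps list_all_iff pairwise_adj_def
    by auto
  have no_cliques: "cliques R (p + 1) [0..<n] = []"
    using cert unfolding L by simp
  show ?thesis
    unfolding folkman_witness_def
  proof safe
    fix K assume K: "K \<subseteq> {..<n}" "pairwise_adj R K"
    show "card K \<le> p"
    proof (rule ccontr)
      assume "\<not> card K \<le> p"
      then obtain K' where "K' \<subseteq> K" "card K' = p + 1"
        by (metis Suc_eq_plus1 not_less_eq_eq obtain_subset_with_card_n)
      then have "cliques R (p + 1) [0..<n] \<noteq> []"
        using K by (intro cliques_nonempty[of _ K'])
          (auto simp: pairwise_adj_def atLeast0LessThan)
      then show False
        using no_cliques by simp
    qed
  next
    fix A B assume AB: "independent R A" "independent R B"
    \<comment> \<open>Stated for arbitrary \<open>A\<close> and \<open>B\<close> so that it also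
      applies with the two exchanged, when \<open>v\<close> lies in the second set.\<close>
    have no_cover: False if indep: "independent R A" "independent R B"
        and cover: "\<forall>K\<in>set L. set K \<inter> (A \<union> B) \<noteq> {}" and v: "v \<in> set K0" "v \<in> A" for A B v
      using hits_if_independent_cover[OF indep, of "[v]" "[]" "filter (\<lambda>K. v \<notin> set K) L'"]
        no_hits[OF v(1)] v(2) cover L by auto
    have "\<exists>K\<in>set L. set K \<inter> (A \<union> B) = {}"
    proof (rule ccontr)
      assume neg: "\<not> ?thesis"
      then have "\<forall>K\<in>set L. set K \<inter> (A \<union> B) \<noteq> {}" "\<forall>K\<in>set L. set K \<inter> (B \<union> A) \<noteq> {}"
        by auto
      moreover from neg obtain v where "v \<in> set K0" "v \<in> A \<or> v \<in> B"
        unfolding L by auto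
      ultimately show False
        using no_cover[OF AB] no_cover[OF AB(2,1)] by blast
    qed
    then obtain K where "K \<in> set L" "set K \<inter> (A \<union> B) = {}"
      by blast
    then show "\<exists>K\<subseteq>{..<n}. pairwise_adj R K \<and> card K = p \<and> K \<inter> A = {} \<and> K \<inter> B = {}"
      using members by (intro exI[of _ "set K"]) blast
  qed
qed

section \<open>Complements of circulant graphs\<close>

text \<open>Each \<open>T\<close> used below contains \<open>n - d\<close> along with
  \<open>d\<close>, so linear and cyclic distance agree and the graph is invariant under rotation
  mod \<open>n\<close>.\<close>

definition distance_avoiding :: "nat list \<Rightarrow> nat \<Rightarrow> nat \<Rightarrow> bool" where
  "distance_avoiding T x y \<longleftrightarrow> y - x \<notin> set T"

text \<open>By this symmetry rotated cliques are cliques, and at most three base cliques describe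
  each family.\<close>

definition rotations :: "nat \<Rightarrow> nat list list \<Rightarrow> nat list list" where
  "rotations n Ks = concat (map (\<lambda>i. map (map (\<lambda>x. (x + i) mod n)) Ks) [0..<n])"

text \<open>
  The distances and the cliques were found by computer search; among isomorphic choices they are the
  ones for which \<^const>\<open>hits\<close> explores few branches.
\<close>

lemma folkman_witness_4_13: "folkman_witness (distance_avoiding [4, 6, 7, 9]) 4 13"
proof -
  have "certificate (distance_avoiding [4, 6, 7, 9]) 4 13
    (rotations 13 [[0, 1, 2, 3], [1, 2, 4, 12], [1, 4, 9, 12]])"
    by code_simp
  then show ?thesis
    by (rule folkman_witness_if_certificate)
qed

lemma folkman_witness_5_22: "folkman_witness (distance_avoiding [4, 9, 10, 11, 12, 13, 18]) 5 22"
proof -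
  have "certificate (distance_avoiding [4, 9, 10, 11, 12, 13, 18]) 5 22
    (rotations 22 [[0, 1, 3, 6, 8], [0, 3, 5, 6, 8]])"
    by code_simp
  then show ?thesis
    by (rule folkman_witness_if_certificate)
qed

lemma folkman_witness_6_21: "folkman_witness (distance_avoiding [4, 9, 10, 11, 12, 17]) 6 21"
proof -
  have "certificate (distance_avoiding [4, 9, 10, 11, 12, 17]) 6 21
    (rotations 21 [[0, 1, 2, 3, 8, 16]])"
    by code_simp
  then show ?thesis
    by (rule folkman_witness_if_certificate)
qed

lemma folkman_witness_7_24: "folkman_witness (distance_avoiding [6, 10, 11, 13, 14, 18]) 7 24"
proof -
  have "certificate (distance_avoiding [6, 10, 11, 13, 14, 18]) 7 24
    (rotations 24 [[0, 1, 2, 4, 5, 9, 21], [0, 1, 2, 5, 9, 17, 21]])"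
    by code_simp
  then show ?thesis
    by (rule folkman_witness_if_certificate)
qed

section \<open>Reduction modulo 4\<close>

lemma folkman_number_add_4_mult_le:
  assumes "folkman_witness R p n"
  shows "folkman_number [2, 2, 4 * k + p] (4 * k + p + 1) \<le> 13 * k + n"
proof -
  have "\<exists>S. folkman_witness S (4 * k + p) (13 * k + n)"
  proof (induction k)
    case 0
    then show ?case
      using assms by auto
  next
    case (Suc k)
    then obtain S where "folkman_witness S (4 * k + p) (13 * k + n)"
      by blast
    from folkman_witness_join[OF folkman_witness_4_13 this] show ?case
      by (auto simp: algebra_simps)
  qed
  then show ?thesis
    using folkman_number_le by blast
qed

theorem corollary2:
  fixes p :: nat
  assumes "p \<ge> 4"
  shows "(p mod 4 = 0 \<longrightarrow> real (folkman_number [2, 2, p] (p + 1)) \<le> 13 * real p / 4) \<and>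
         (p mod 4 = 1 \<longrightarrow> real (folkman_number [2, 2, p] (p + 1)) \<le> (13 * real p + 23) / 4) \<and>
         (p mod 4 = 2 \<longrightarrow> real (folkman_number [2, 2, p] (p + 1)) \<le> (13 * real p + 10) / 4) \<and>
         (p mod 4 = 3 \<longrightarrow> real (folkman_number [2, 2, p] (p + 1)) \<le> (13 * real p + 21) / 4)"
proof -
  \<comment> \<open>The base case is \<open>4 + p mod 4\<close>, between 4 and 7; \<open>k\<close>
    copies of the 13-vertex graph supply the rest.\<close>
  define k where "k = p div 4 - 1"
  have p: "p = 4 * k + (4 + p mod 4)"
    unfolding k_def using assms by presburger
  have bounds:
    "p mod 4 = 0 \<Longrightarrow> folkman_number [2, 2, p] (p + 1) \<le> 13 * k + 13"
    "p mod 4 = 1 \<Longrightarrow> folkman_number [2, 2, p] (p + 1) \<le> 13 * k + 22"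
    "p mod 4 = 2 \<Longrightarrow> folkman_number [2, 2, p] (p + 1) \<le> 13 * k + 21"
    "p mod 4 = 3 \<Longrightarrow> folkman_number [2, 2, p] (p + 1) \<le> 13 * k + 24"
    using p folkman_number_add_4_mult_le[OF folkman_witness_4_13, of k]
      folkman_number_add_4_mult_le[OF folkman_witness_5_22, of k]
      folkman_number_add_4_mult_le[OF folkman_witness_6_21, of k]
      folkman_number_add_4_mult_le[OF folkman_witness_7_24, of k]
    by simp_all
  have "real p = 4 * real k + 4 + real (p mod 4)"
    using arg_cong[OF p, of real] by simp
  \<comment> \<open>In terms of \<open>p\<close> the bounds are 13p/4, (13p+23)/4, (13p+6)/4 and
    (13p+5)/4; the last two are sharper than claimed.\<close>
  then show ?thesis
    using bounds[THEN of_nat_mono[where 'a = real]] by auto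
qed

end
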